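(* Let $G$ be a finite group containing a difference set (respectively, a partial difference set) $D$, and let $\mathrm{Aut}(G)_D$ be the subgroup of automorphisms of $G$ that stabilize $D$ setwise. Let $\mathcal{G} \le \mathrm{Aut}(G)_D \ltimes G$ be a subgroup satisfying: (i) $|\mathcal{G}| = |G|$; (ii) writing $1 \times X = (1 \times G) \cap \mathcal{G}$ with $X \le G$, the subgroup $X$ is normal in $G$ and $1 \times X$ is normal in $\mathcal{G}$; and (iii) the action of $\mathcal{G}$ on $[G:X]$, the set of right cosets of $X$ in $G$, given by $$(Xh)^{(\phi,g)} := X^\phi h^\phi g = X h^\phi g$$ is transitive on $[G:X]$. Then $\mathcal{G}$ contains a difference set (respectively, a partial difference set) $\mathcal{D}$ with the same parameters as $D$.
   Context: All groups are finite. A subset $D$ of a finite group $G$ is a $(v,k,\lambda)$-difference set (DS) if $|G|=v$, $|D|=k$, and every $g \in G\setminus\{1\}$ can be expressed in exactly $\lambda$ ways as $d_1d_2^{-1}$ with $d_1,d_2\in D$. A subset $D$ of $G$ is a $(v,k,\lambda,\mu)$-partial difference set (PDS) if $|G|=v$, $|D|=k$, every nonidentity $g\in D$ can be expressed as $d_1d_2^{-1}$ with $d_1,d_2\in D$ in exactly $\lambda$ ways, and every $g\in G\setminus(D\cup\{1\})$ can be so expressed in exactly $\mu$ ways. "Same parameters" means the same $(v,k,\lambda)$, respectively the same $(v,k,\lambda,\mu)$. Automorphisms act on the right, written $g\mapsto g^\phi$, and $\phi\psi$ means first $\phi$, then $\psi$. The semidirect product $\mathrm{Aut}(G)_D\ltimes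 G$ is the set of pairs $(\phi,g)$ with $\phi \in \mathrm{Aut}(G)_D$, $g\in G$, and multiplication $(\phi,g)(\psi,h)=(\phi\psi,\,g^\psi h)$; $1\times G$ is the subgroup of pairs $(1,g)$. *)

theory Defs
  imports "HOL-Algebra.Coset" "HOL-Algebra.Bij"
begin

definition quotient_reps :: "('a, 'b) monoid_scheme \<Rightarrow> 'a set \<Rightarrow> 'a \<Rightarrow> ('a \<times> 'a) set"
  where "quotient_reps G D g = {(d1, d2) \<in> D \<times> D. d1 \<otimes>\<^bsub>G\<^esub> inv\<^bsub>G\<^esub> d2 = g}"

definition difference_set ::
    "('a, 'b) monoid_scheme \<Rightarrow> nat \<Rightarrow> nat \<Rightarrow> nat \<Rightarrow> 'a set \<Rightarrow> bool"
  where "difference_set G v k l D \<longleftrightarrow>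
    D \<subseteq> carrier G \<and> order G = v \<and> card D = k \<and>
    (\<forall>g \<in> carrier G - {\<one>\<^bsub>G\<^esub>}. card (quotient_reps G D g) = l)"

text \<open>As in the source, \<open>D\<close> need be neither closed under inverses nor free of the identity.\<close>

definition partial_difference_set ::
    "('a, 'b) monoid_scheme \<Rightarrow> nat \<Rightarrow> nat \<Rightarrow> nat \<Rightarrow> nat \<Rightarrow> 'a set \<Rightarrow> bool"
  where "partial_difference_set G v k l m D \<longleftrightarrow>
    D \<subseteq> carrier G \<and> order G = v \<and> card D = k \<and>
    (\<forall>g \<in> D - {\<one>\<^bsub>G\<^esub>}. card (quotient_reps G D g) = l) \<and>
    (\<forall>g \<in> carrier G - (D \<union> {\<one>\<^bsub>G\<^esub>}). card (quotient_reps G D g) = m)"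

definition aut_stabilizer :: "('a, 'b) monoid_scheme \<Rightarrow> 'a set \<Rightarrow> ('a \<Rightarrow> 'a) set"
  where "aut_stabilizer G D = {\<phi> \<in> auto G. \<phi> ` D = D}"

text \<open>
  Automorphisms act on the right, \<open>g\<^sup>\<phi> = \<phi> g\<close>, and \<open>\<phi>\<psi>\<close> means first \<open>\<phi>\<close>, then \<open>\<psi>\<close>. The
  product of \<^const>\<open>AutoGroup\<close> composes in the opposite order, so \<open>\<phi>\<psi>\<close> is written there as
  \<open>\<psi> \<otimes> \<phi>\<close>.
\<close>

definition semidirect ::
    "('a, 'b) monoid_scheme \<Rightarrow> ('a \<Rightarrow> 'a) set \<Rightarrow> (('a \<Rightarrow> 'a) \<times> 'a) monoid"
  where "semidirect G A =
    \<lparr>carrier = A \<times> carrier G,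
     mult = \<lambda>(\<phi>, g) (\<psi>, h). (\<psi> \<otimes>\<^bsub>AutoGroup G\<^esub> \<phi>, \<psi> g \<otimes>\<^bsub>G\<^esub> h),
     one = (\<one>\<^bsub>AutoGroup G\<^esub>, \<one>\<^bsub>G\<^esub>)\<rparr>"

definition coset_action :: "('a, 'b) monoid_scheme \<Rightarrow> 'a set \<Rightarrow> ('a \<Rightarrow> 'a) \<times> 'a \<Rightarrow> 'a set"
  where "coset_action G C = (\<lambda>(\<phi>, g). (\<phi> ` C) #>\<^bsub>G\<^esub> g)"

lemma (in group) coset_action_rcoset:
  assumes "\<phi> \<in> auto G" "\<phi> ` X = X" "X \<subseteq> carrier G" "h \<in> carrier G" "g \<in> carrier G"
  shows "coset_action G (X #> h) (\<phi>, g) = X #> (\<phi> h \<otimes> g)"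
proof -
  have hom: "\<phi> \<in> hom G G" using assms(1) by (simp add: auto_def)
  have "\<phi> ` (X #> h) = (\<lambda>x. \<phi> x \<otimes> \<phi> h) ` X"
    using hom assms(3,4) by (auto simp: r_coset_def image_iff hom_mult subset_iff)
  also have "\<dots> = \<phi> ` X #> \<phi> h" by (auto simp: r_coset_def)
  finally show ?thesis
    using assms hom by (simp add: coset_action_def coset_mult_assoc hom_in_carrier)
qed

lemma (in group) subgroup_aut_stabilizer:
  assumes "D \<subseteq> carrier G"
  shows "subgroup (aut_stabilizer G D) (AutoGroup G)"
proof -
  interpret A: group "AutoGroup G" by (rule AutoGroup)
  have mult: "\<psi> \<otimes>\<^bsub>AutoGroup G\<^esub> \<phi> = compose (carrier G) \<psi> \<phi>"
    if "\<phi> \<in> auto G" "\<psi> \<in> auto G" for \<phi> \<psi>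
    using that by (simp add: AutoGroup_def BijGroup_def auto_def)
  have car: "carrier (AutoGroup G) = auto G" by (simp add: AutoGroup_def)
  have one: "\<one>\<^bsub>AutoGroup G\<^esub> = (\<lambda>x\<in>carrier G. x)"
    by (simp add: AutoGroup_def BijGroup_def)
  have comp: "compose (carrier G) \<psi> \<phi> ` D = \<psi> ` \<phi> ` D" for \<phi> \<psi> :: "'a \<Rightarrow> 'a"
    using assms by (force simp: compose_def)
  have id: "(\<lambda>x\<in>carrier G. x) ` D = D" using assms by force
  show ?thesis
  proof (rule A.subgroupI)
    show "aut_stabilizer G D \<subseteq> carrier (AutoGroup G)"
      by (auto simp: aut_stabilizer_def car)
    show "aut_stabilizer G D \<noteq> {}"
      using id id_in_auto unfolding aut_stabilizer_def by blast
  next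
    fix \<phi> assume \<phi>: "\<phi> \<in> aut_stabilizer G D"
    let ?i = "inv\<^bsub>AutoGroup G\<^esub> \<phi>"
    have c: "\<phi> \<in> auto G" "?i \<in> auto G" and D: "\<phi> ` D = D"
      using \<phi> A.inv_closed by (auto simp: aut_stabilizer_def car)
    have "compose (carrier G) ?i \<phi> = (\<lambda>x\<in>carrier G. x)"
      using A.l_inv[of \<phi>] c by (simp add: car mult one)
    then have "?i ` \<phi> ` D = D" using comp id by metis
    then show "?i \<in> aut_stabilizer G D" using c D by (simp add: aut_stabilizer_def)
  next
    fix \<psi> \<phi> assume "\<psi> \<in> aut_stabilizer G D" "\<phi> \<in> aut_stabilizer G D"
    then show "\<psi> \<otimes>\<^bsub>AutoGroup G\<^esub> \<phi> \<in> aut_stabilizer G D"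
      using A.m_closed[of \<psi> \<phi>] by (auto simp: aut_stabilizer_def car mult comp)
  qed
qed

lemma (in group) group_semidirect:
  assumes "subgroup A (AutoGroup G)"
  shows "group (semidirect G A)"
proof -
  interpret A: group "AutoGroup G" by (rule AutoGroup)
  have car: "carrier (AutoGroup G) = auto G" by (simp add: AutoGroup_def)
  have A: "\<phi> \<in> auto G" if "\<phi> \<in> A" for \<phi>
    using subgroup.subset[OF assms] that by (auto simp: car)
  have hom: "\<phi> \<in> hom G G" if "\<phi> \<in> A" for \<phi> using A[OF that] by (simp add: auto_def)
  have app: "(\<psi> \<otimes>\<^bsub>AutoGroup G\<^esub> \<phi>) x = \<psi> (\<phi> x)"
    if "\<phi> \<in> A" "\<psi> \<in> A" "x \<in> carrier G" for \<phi> \<psi> x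
    using that A[of \<phi>] A[of \<psi>]
    by (simp add: AutoGroup_def BijGroup_def auto_def compose_def)
  have one: "\<one>\<^bsub>AutoGroup G\<^esub> x = x" if "x \<in> carrier G" for x
    using that by (simp add: AutoGroup_def BijGroup_def)
  have mem: "\<phi> x \<in> carrier G" if "\<phi> \<in> A" "x \<in> carrier G" for \<phi> x
    using hom_in_carrier[OF hom] that by blast
  have fix1: "\<phi> \<one> = \<one>" if "\<phi> \<in> A" for \<phi>
    using hom_one[OF hom[OF that] is_group is_group] .
  note cl = subgroup.m_closed[OF assms] subgroup.one_closed[OF assms]
    subgroup.m_inv_closed[OF assms]
  show ?thesis
  proof (rule groupI)
    fix x y z
    assume "x \<in> carrier (semidirect G A)" "y \<in> carrier (semidirect G A)"
      "z \<in> carrier (semidirect G A)"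
    then show "x \<otimes>\<^bsub>semidirect G A\<^esub> y \<otimes>\<^bsub>semidirect G A\<^esub> z
      = x \<otimes>\<^bsub>semidirect G A\<^esub> (y \<otimes>\<^bsub>semidirect G A\<^esub> z)"
      using A by (auto simp: semidirect_def A.m_assoc car app mem hom_mult[OF hom] m_assoc)
  next
    fix x assume x: "x \<in> carrier (semidirect G A)"
    obtain \<phi> g where xe: "x = (\<phi>, g)" by (cases x)
    have "\<phi> \<in> A" "g \<in> carrier G" using x by (auto simp: semidirect_def xe)
    then show "\<exists>y\<in>carrier (semidirect G A).
        y \<otimes>\<^bsub>semidirect G A\<^esub> x = \<one>\<^bsub>semidirect G A\<^esub>"
      using A cl mem app[of "inv\<^bsub>AutoGroup G\<^esub> \<phi>" \<phi> "inv g"] one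
      by (intro bexI[of _ "(inv\<^bsub>AutoGroup G\<^esub> \<phi>, (inv\<^bsub>AutoGroup G\<^esub> \<phi>) (inv g))"])
        (auto simp: semidirect_def xe car)
  qed (use A cl mem one fix1 in \<open>auto simp: semidirect_def car\<close>)
qed

end

theory Submission
  imports Defs
begin

text \<open>
  Let \<open>K\<close> act on \<open>G\<close> by \<open>h\<^bsup>(\<phi>,g)\<^esup> = \<phi> h \<otimes> g\<close>, so that \<open>(\<phi>, g)\<close> sends \<open>\<one>\<close> to \<open>g\<close>. This action is
  regular: transitivity on the cosets of \<open>X\<close> moves \<open>\<one>\<close> into every coset, the translations
  \<open>1 \<times> X\<close> in \<open>K\<close> move it further to every element of that coset, and \<open>|K| = |G|\<close> leaves no room
  for a nontrivial stabilizer. Hence \<open>(\<phi>, g) \<mapsto> g\<close> is a bijection from \<open>K\<close> onto \<open>G\<close>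
  (\<open>bij_betw_snd_of_coset_transitive\<close>).

  The action also permutes the translates of \<open>D\<close>, because
  \<open>(D \<otimes> h)\<^bsup>(\<phi>,g)\<^esup> = D \<otimes> (\<phi> h \<otimes> g)\<close> when \<open>\<phi>\<close> stabilizes \<open>D\<close>. So \<open>K\<close> is, like \<open>G\<close> itself, a
  regular group of automorphisms of the incidence structure formed by these translates, and such a
  group inherits the difference set: take \<open>E = {(\<phi>, g) \<in> K. g \<in> D}\<close>. In terms of elements, for
  \<open>c \<in> K\<close> with second component \<open>g\<close>, the representations of \<open>c\<close> as a quotient from \<open>E\<close>
  correspond to those \<open>b \<in> K\<close> for which both \<open>\<one>\<^bsup>b\<^esup>\<close> and \<open>g\<^bsup>b\<^esup>\<close> lie in \<open>D\<close>. Applying \<open>b\<inverse>\<close>, which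
  maps \<open>D\<close> to \<open>D \<otimes> t\<close> with \<open>t = \<one>\<^bsup>b\<inverse>\<^esup>\<close>, this says that \<open>t\<inverse>\<close> and \<open>g \<otimes> t\<inverse>\<close> lie in \<open>D\<close>, which
  is a representation of \<open>g\<close> as a quotient from \<open>D\<close>. Since \<open>b \<mapsto> t\<close> is a bijection, \<open>c\<close> and \<open>g\<close>
  have equally many representations (\<open>card_quotient_reps_transfer\<close>).
\<close>

text \<open>The first entry of a representing pair is determined by the second one.\<close>

lemma (in group) card_quotient_reps:
  assumes "D \<subseteq> carrier G" "g \<in> carrier G"
  shows "card (quotient_reps G D g) = card {d \<in> D. g \<otimes> d \<in> D}"
proof -
  have "bij_betw (\<lambda>d. (g \<otimes> d, d)) {d \<in> D. g \<otimes> d \<in> D} (quotient_reps G D g)"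
  proof (rule bij_betwI[where g = snd])
    show "(\<lambda>d. (g \<otimes> d, d)) \<in> {d \<in> D. g \<otimes> d \<in> D} \<rightarrow> quotient_reps G D g"
      using assms by (auto simp: quotient_reps_def subset_iff m_assoc)
    show "snd \<in> quotient_reps G D g \<rightarrow> {d \<in> D. g \<otimes> d \<in> D}"
      using assms by (auto simp: quotient_reps_def subset_iff m_assoc)
    show "(g \<otimes> snd x, snd x) = x" if "x \<in> quotient_reps G D g" for x
      using that assms by (auto simp: quotient_reps_def subset_iff m_assoc)
  qed simp
  from bij_betw_same_card[OF this] show ?thesis by (rule sym)
qed

text \<open>
  Since every nonidentity element has \<open>l\<close> representations exactly when those inside and those
  outside \<open>D\<close> do, difference sets need no separate treatment.
\<close>

lemma difference_set_iff_partial_difference_set: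
  "difference_set G v k l D \<longleftrightarrow> partial_difference_set G v k l l D"
proof (cases "D \<subseteq> carrier G")
  case True
  then have "carrier G - {\<one>\<^bsub>G\<^esub>} = (D - {\<one>\<^bsub>G\<^esub>}) \<union> (carrier G - (D \<union> {\<one>\<^bsub>G\<^esub>}))"
    by auto
  then show ?thesis
    by (simp only: difference_set_def partial_difference_set_def ball_Un conj_assoc)
next
  case False
  then show ?thesis by (simp add: difference_set_def partial_difference_set_def)
qed

lemma (in group) bij_betw_m_inv: "bij_betw (m_inv G) (carrier G) (carrier G)"
  by (rule bij_betwI[where g = "m_inv G"]) auto

text \<open>
  Here \<open>p b\<close> stands for \<open>\<one>\<^bsup>b\<^esup>\<close> under a regular action of \<open>H\<close> on \<open>G\<close>, so that \<open>p (c \<otimes> b)\<close> is the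
  image of \<open>p c\<close> under \<open>b\<close>. The hypothesis \<open>D\<close> says that the preimage of \<open>D\<close> under \<open>b\<close> is the
  translate \<open>D \<otimes> p (inv b)\<close>.
\<close>

lemma card_quotient_reps_transfer:
  fixes G (structure) and H (structure)
  assumes G: "group G" and H: "group H" and DG: "D \<subseteq> carrier G"
    and bij: "bij_betw p (carrier H) (carrier G)"
    and one: "p \<one>\<^bsub>H\<^esub> = \<one>\<^bsub>G\<^esub>"
    and D: "\<And>b c. \<lbrakk>b \<in> carrier H; c \<in> carrier H\<rbrakk> \<Longrightarrow>
      p (c \<otimes>\<^bsub>H\<^esub> b) \<in> D \<longleftrightarrow> p c \<otimes>\<^bsub>G\<^esub> inv\<^bsub>G\<^esub> p (inv\<^bsub>H\<^esub> b) \<in> D"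
    and c: "c \<in> carrier H"
  shows "card (quotient_reps H {b \<in> carrier H. p b \<in> D} c) = card (quotient_reps G D (p c))"
proof -
  interpret G: group G by (rule G)
  interpret H: group H by (rule H)
  let ?E = "{b \<in> carrier H. p b \<in> D}" and ?t = "\<lambda>b. inv\<^bsub>G\<^esub> p (inv\<^bsub>H\<^esub> b)"
  have pG: "p b \<in> carrier G" if "b \<in> carrier H" for b
    using bij that by (auto simp: bij_betw_def)
  have t: "bij_betw ?t (carrier H) (carrier G)"
    using bij_betw_trans[OF bij_betw_trans[OF H.bij_betw_m_inv bij] G.bij_betw_m_inv]
    by (simp add: comp_def)
  have E: "p b \<in> D \<longleftrightarrow> ?t b \<in> D" if "b \<in> carrier H" for b
    using D[OF that H.one_closed] that one pG by simp
  have "bij_betw ?t {b \<in> ?E. c \<otimes>\<^bsub>H\<^esub> b \<in> ?E} {d \<in> D. p c \<otimes>\<^bsub>G\<^esub> d \<in> D}"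
  proof -
    have "?t ` {b \<in> ?E. c \<otimes>\<^bsub>H\<^esub> b \<in> ?E}
        = ?t ` {b \<in> carrier H. ?t b \<in> D \<and> p c \<otimes>\<^bsub>G\<^esub> ?t b \<in> D}"
      using E D c by (intro arg_cong[where f = "image ?t"]) auto
    also have "\<dots> = {d \<in> ?t ` carrier H. d \<in> D \<and> p c \<otimes>\<^bsub>G\<^esub> d \<in> D}" by blast
    also have "\<dots> = {d \<in> D. p c \<otimes>\<^bsub>G\<^esub> d \<in> D}"
      using t DG by (auto simp: bij_betw_def)
    finally show ?thesis
      using t by (auto simp: bij_betw_def intro: inj_on_subset)
  qed
  then show ?thesis
    using G.card_quotient_reps[OF DG pG[OF c]] H.card_quotient_reps[of ?E c] c
    by (auto dest: bij_betw_same_card)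
qed

lemma partial_difference_set_transfer:
  fixes G (structure) and H (structure)
  assumes G: "group G" and H: "group H"
    and bij: "bij_betw p (carrier H) (carrier G)"
    and one: "p \<one>\<^bsub>H\<^esub> = \<one>\<^bsub>G\<^esub>"
    and D: "\<And>b c. \<lbrakk>b \<in> carrier H; c \<in> carrier H\<rbrakk> \<Longrightarrow>
      p (c \<otimes>\<^bsub>H\<^esub> b) \<in> D \<longleftrightarrow> p c \<otimes>\<^bsub>G\<^esub> inv\<^bsub>G\<^esub> p (inv\<^bsub>H\<^esub> b) \<in> D"
    and pds: "partial_difference_set G v k l m D"
  shows "partial_difference_set H v k l m {b \<in> carrier H. p b \<in> D}"
proof -
  interpret H: group H by (rule H)
  let ?E = "{b \<in> carrier H. p b \<in> D}"
  have DG: "D \<subseteq> carrier G" using pds by (simp add: partial_difference_set_def)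
  have inj: "inj_on p (carrier H)" and img: "p ` carrier H = carrier G"
    using bij by (auto simp: bij_betw_def)
  have "p ` ?E = p ` carrier H \<inter> D" by blast
  then have "p ` ?E = D" using img DG by blast
  moreover have "inj_on p ?E" by (rule inj_on_subset[OF inj]) blast
  ultimately have "card ?E = card D" by (metis card_image)
  moreover have "order H = order G"
    using bij by (simp add: order_def bij_betw_same_card)
  moreover have "p c \<noteq> \<one>\<^bsub>G\<^esub>" if "c \<in> carrier H" "c \<noteq> \<one>\<^bsub>H\<^esub>" for c
    using inj that one by (metis H.one_closed inj_onD)
  moreover have "p c \<in> carrier G" if "c \<in> carrier H" for c using that img by blast
  ultimately show ?thesis
    using pds card_quotient_reps_transfer[OF G H DG bij one D]
    by (auto simp: partial_difference_set_def)
qed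

lemma mult_semidirect [simp]:
  "(\<phi>, g) \<otimes>\<^bsub>semidirect G A\<^esub> (\<psi>, h) = (\<psi> \<otimes>\<^bsub>AutoGroup G\<^esub> \<phi>, \<psi> g \<otimes>\<^bsub>G\<^esub> h)"
  by (simp add: semidirect_def)

text \<open>
  For \<open>h \<in> G\<close> some \<open>(\<phi>, g) \<in> K\<close> takes \<open>X\<close> to the coset of \<open>h\<close>. Then \<open>g\<close> itself lies in that
  coset, and as \<open>X\<close> is normal \<open>g = h \<otimes> x\<close> for some \<open>x \<in> X\<close>; right multiplication by
  \<open>(1, x\<inverse>)\<close> turns \<open>g\<close> into \<open>h\<close>. Thus \<open>snd\<close> is onto \<open>G\<close>, and counting makes it injective.
\<close>

lemma (in group) bij_betw_snd_of_coset_transitive: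
  assumes fin: "finite (carrier G)" and A: "A \<subseteq> auto G"
    and K: "subgroup K (semidirect G A)" and card: "card K = order G"
    and XK: "{\<one>\<^bsub>AutoGroup G\<^esub>} \<times> X \<subseteq> K" and X: "X \<lhd> G"
    and trans: "\<And>B. B \<in> rcosets X \<Longrightarrow> \<exists>a \<in> K. coset_action G X a = B"
  shows "bij_betw snd K (carrier G)"
proof -
  interpret X: normal X G by (rule X)
  have sub: "K \<subseteq> A \<times> carrier G"
    using subgroup.subset[OF K] by (simp add: semidirect_def)
  have "h \<in> snd ` K" if h: "h \<in> carrier G" for h
  proof -
    have "X #> h \<in> rcosets X" using h by (auto simp: RCOSETS_def)
    then obtain \<phi> g where a: "(\<phi>, g) \<in> K" and eq: "coset_action G X (\<phi>, g) = X #> h"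
      using trans by (metis surj_pair)
    have \<phi>: "\<phi> \<in> auto G" and g: "g \<in> carrier G" using a sub A by auto
    have "\<phi> \<one> = \<one>"
      using \<phi> hom_one[OF _ is_group is_group] by (simp add: auto_def)
    then have "\<one> \<in> \<phi> ` X" using X.one_closed by (metis imageI)
    then have "\<one> \<otimes> g \<in> \<phi> ` X #> g" unfolding r_coset_def by blast
    then have "g \<in> h <# X"
      using eq g h X.coset_eq by (simp add: coset_action_def)
    then obtain x where x: "x \<in> X" and gx: "g = h \<otimes> x" by (auto simp: l_coset_def)
    have "(\<phi>, g) \<otimes>\<^bsub>semidirect G A\<^esub> (\<one>\<^bsub>AutoGroup G\<^esub>, inv x) \<in> K"
      using XK x by (intro subgroup.m_closed[OF K a]) auto
    moreover have "\<one>\<^bsub>AutoGroup G\<^esub> g = g"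
      using g by (simp add: AutoGroup_def BijGroup_def)
    moreover have "g \<otimes> inv x = h" using gx h x by (simp add: m_assoc)
    ultimately show ?thesis by force
  qed
  then have img: "snd ` K = carrier G" using sub by auto
  \<comment> \<open>An infinite \<open>K\<close> would have cardinality \<open>0\<close>.\<close>
  have "card (carrier G) > 0" using fin by (simp add: card_gt_0_iff) blast
  then have "finite K" using card by (metis card_ge_0_finite order_def)
  then show ?thesis
    using img card by (simp add: bij_betw_def eq_card_imp_inj_on order_def)
qed

text \<open>
  With \<open>b = (\<psi>, h)\<close> and \<open>c = (\<phi>, g)\<close>, the second components of \<open>inv b \<otimes> b = \<one>\<close> show that \<open>\<psi>\<close>
  maps that of \<open>inv b\<close> to \<open>inv h\<close>. So \<open>\<psi>\<close> maps the element on the right to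
  \<open>\<psi> g \<otimes> h = snd (c \<otimes> b)\<close>, and an automorphism in the stabilizer of \<open>D\<close> preserves membership in \<open>D\<close>.
\<close>

lemma (in group) snd_mult_mem_iff:
  assumes DG: "D \<subseteq> carrier G"
    and b: "b \<in> carrier (semidirect G (aut_stabilizer G D))"
    and c: "c \<in> carrier (semidirect G (aut_stabilizer G D))"
  shows "snd (c \<otimes>\<^bsub>semidirect G (aut_stabilizer G D)\<^esub> b) \<in> D
    \<longleftrightarrow> snd c \<otimes> inv snd (inv\<^bsub>semidirect G (aut_stabilizer G D)\<^esub> b) \<in> D"
proof -
  let ?S = "semidirect G (aut_stabilizer G D)"
  interpret S: group ?S
    by (intro group_semidirect subgroup_aut_stabilizer DG)
  obtain \<psi> h where be: "b = (\<psi>, h)" by (cases b)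
  obtain \<phi> g where ce: "c = (\<phi>, g)" by (cases c)
  obtain \<psi>' t where ie: "inv\<^bsub>?S\<^esub> b = (\<psi>', t)" by (cases "inv\<^bsub>?S\<^esub> b")
  have \<psi>: "\<psi> \<in> auto G" "\<psi> ` D = D" and h: "h \<in> carrier G" and g: "g \<in> carrier G"
    using b c by (auto simp: semidirect_def be ce aut_stabilizer_def)
  have "(\<psi>', t) \<in> carrier ?S" using S.inv_closed[OF b] by (simp only: ie)
  then have t: "t \<in> carrier G" by (simp add: semidirect_def)
  have hom: "\<psi> \<in> hom G G" and inj: "inj_on \<psi> (carrier G)"
    using \<psi>(1) by (auto simp: auto_def Bij_def bij_betw_def)
  interpret \<psi>: group_hom G G \<psi> by (simp add: group_hom_def group_hom_axioms_def hom is_group)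
  have "(\<psi>', t) \<otimes>\<^bsub>?S\<^esub> (\<psi>, h) = \<one>\<^bsub>?S\<^esub>"
    using S.l_inv[OF b] unfolding ie unfolding be .
  then have "\<psi> t \<otimes> h = \<one>" by (simp add: semidirect_def)
  then have "inv h = \<psi> t" using h t by (intro inv_equality) auto
  then have "\<psi> (inv t) = h" using t inv_inv[OF h] by simp
  then have "\<psi> (g \<otimes> inv t) = \<psi> g \<otimes> h" using g t by simp
  moreover have "\<psi> x \<in> D \<longleftrightarrow> x \<in> D" if "x \<in> carrier G" for x
    using inj_on_image_mem_iff[OF inj that DG] \<psi>(2) by simp
  ultimately have "\<psi> g \<otimes> h \<in> D \<longleftrightarrow> g \<otimes> inv t \<in> D" using g t by (metis inv_closed m_closed)
  moreover have "snd (c \<otimes>\<^bsub>?S\<^esub> b) = \<psi> g \<otimes> h" unfolding be ce by simp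
  ultimately show ?thesis unfolding ie by (simp add: ce)
qed

theorem theorem1p1:
  fixes G :: "('a, 'b) monoid_scheme" (structure)
    and D X :: "'a set"
    and K :: "(('a \<Rightarrow> 'a) \<times> 'a) set"
    and v k l m :: nat
  assumes "group G" and "finite (carrier G)" and "D \<subseteq> carrier G"
    and "subgroup K (semidirect G (aut_stabilizer G D))"
    and "card K = order G"
    and "({\<one>\<^bsub>AutoGroup G\<^esub>} \<times> carrier G) \<inter> K = {\<one>\<^bsub>AutoGroup G\<^esub>} \<times> X"
    and "X \<lhd> G"
    and "({\<one>\<^bsub>AutoGroup G\<^esub>} \<times> X) \<lhd> (semidirect G (aut_stabilizer G D)\<lparr>carrier := K\<rparr>)"
    and "\<forall>A \<in> rcosets X. \<forall>B \<in> rcosets X. \<exists>a \<in> K. coset_action G A a = B"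
  shows "(difference_set G v k l D \<longrightarrow>
            (\<exists>E. difference_set (semidirect G (aut_stabilizer G D)\<lparr>carrier := K\<rparr>) v k l E)) \<and>
         (partial_difference_set G v k l m D \<longrightarrow>
            (\<exists>E. partial_difference_set (semidirect G (aut_stabilizer G D)\<lparr>carrier := K\<rparr>) v k l m E))"
proof -
  interpret group G by (rule assms(1))
  let ?S = "semidirect G (aut_stabilizer G D)"
  let ?H = "?S\<lparr>carrier := K\<rparr>"
  have S: "group ?S" by (intro group_semidirect subgroup_aut_stabilizer assms(3))
  have H: "group ?H" by (rule subgroup.subgroup_is_group[OF assms(4) S])
  have KS: "b \<in> carrier ?S" if "b \<in> K" for b
    using subgroup.subset[OF assms(4)] that by blast
  have "X \<in> rcosets X"
    using subgroup.subgroup_in_rcosets[OF normal.axioms(1)[OF assms(7)] is_group] .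
  then have "bij_betw snd K (carrier G)"
    using assms(2,4-7,9)
    by (intro bij_betw_snd_of_coset_transitive[of "aut_stabilizer G D"])
      (auto simp: aut_stabilizer_def)
  then have bij: "bij_betw snd (carrier ?H) (carrier G)" by simp
  have one: "snd \<one>\<^bsub>?H\<^esub> = \<one>" by (simp add: semidirect_def)
  have D: "snd (c \<otimes>\<^bsub>?H\<^esub> b) \<in> D \<longleftrightarrow> snd c \<otimes> inv snd (inv\<^bsub>?H\<^esub> b) \<in> D"
    if "b \<in> carrier ?H" "c \<in> carrier ?H" for b c
    using that snd_mult_mem_iff[OF assms(3) KS KS] group.m_inv_consistent[OF S assms(4)] by simp
  show ?thesis
    unfolding difference_set_iff_partial_difference_set
    using partial_difference_set_transfer[OF is_group H bij one D] by blast
qed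

end
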